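(* Let $r$ and $t$ be integers with $\frac{r}{4} < t \leq r-1$. If $\mathcal{H}$ is an $r$-uniform $r$-partite $t$-intersecting hypergraph, then $\tau(\mathcal{H}) \leq r-t$.
   Context: A hypergraph $\mathcal{H}=(V,E)$ has a finite vertex set $V$ and a multiset $E$ of subsets of $V$ (hyperedges). It is $r$-uniform if every hyperedge has exactly $r$ vertices; $r$-partite if $V$ has a partition into $r$ nonempty classes such that no hyperedge contains two vertices of the same class; $t$-intersecting if every two hyperedges share at least $t$ vertices. The vertex covering number is $\tau(\mathcal{H})=\min\{|T| : T\subseteq V,\ T\cap f\neq\emptyset \text{ for all } f\in E\}$. *)

theory Defs
  imports Complex_Main "HOL-Library.Multiset" "HOL-Library.Disjoint_Sets"
begin

definition hypergraph :: "'a set \<Rightarrow> 'a set multiset \<Rightarrow> bool" where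
  "hypergraph V E \<longleftrightarrow> finite V \<and> (\<forall>e\<in>#E. e \<subseteq> V)"

definition uniform :: "nat \<Rightarrow> 'a set multiset \<Rightarrow> bool" where
  "uniform r E \<longleftrightarrow> (\<forall>e\<in>#E. card e = r)"

(* partition_on includes that the classes are nonempty. *)
definition partite :: "nat \<Rightarrow> 'a set \<Rightarrow> 'a set multiset \<Rightarrow> bool" where
  "partite r V E \<longleftrightarrow>
     (\<exists>P. partition_on V P \<and> card P = r \<and>
          (\<forall>e\<in>#E. \<forall>C\<in>P. \<not> (\<exists>x y. x \<noteq> y \<and> {x, y} \<subseteq> e \<and> {x, y} \<subseteq> C)))"

(* The submultiset condition says that e and f are two members of E counted with
   multiplicity: e = f is included exactly when e is a repeated hyperedge. *)
definition intersecting :: "nat \<Rightarrow> 'a set multiset \<Rightarrow> bool" where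
  "intersecting t E \<longleftrightarrow> (\<forall>e f. {#e, f#} \<subseteq># E \<longrightarrow> t \<le> card (e \<inter> f))"

definition vertex_cover :: "'a set \<Rightarrow> 'a set multiset \<Rightarrow> 'a set \<Rightarrow> bool" where
  "vertex_cover V E T \<longleftrightarrow> T \<subseteq> V \<and> (\<forall>f\<in>#E. T \<inter> f \<noteq> {})"

(* Meaningful when a cover exists, i.e. when V is finite and every hyperedge is a
   nonempty subset of V (then V itself is a cover); otherwise Min may be unspecified. *)
definition covering_number :: "'a set \<Rightarrow> 'a set multiset \<Rightarrow> nat" where
  "covering_number V E = Min {card T | T. vertex_cover V E T}"

end

(* Suppose that no cover has at most r - t vertices. Deleting a t-set P from an edge e leaves r - t
   vertices, which do not form a cover, so every t-subset P of e is of the form e Int f for an edge f.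
   Covers built from vertices of two edges show (here 4 t > r enters) that any two distinct edges
   share exactly t vertices. If f and g both met e in P, then e, f, g would be a sunflower, and
   the kernel (or r - t vertices of it) would be a cover, again because 4 t > r; so f is unique.
   Hence there are 1 + (r choose t) edges, and every vertex that lies in an edge has degree
   1 + ((r - 1) choose (t - 1)). Double counting bounds the number of these vertices in a class by
   r - t; but these vertices form a cover. *)

theory Submission
  imports Defs
begin

text \<open>The setting of an argument by contradiction. Edges form a set, since repetitions do not
  affect covers; \<open>bij\<close> merges uniformity and partiteness: an edge with \<open>r\<close>
  vertices uses each of the \<open>r\<close> classes once.\<close>

locale uncoverable =
  fixes r t :: nat and F :: "'a set set" and cl :: "'a \<Rightarrow> 'c" and I :: "'c set"
  assumes t_pos: "0 < t" and t_less: "t < r" and r_less: "r < 4 * t"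
    and finite_F: "finite F"
    and finite_edge: "e \<in> F \<Longrightarrow> finite e"
    and bij: "e \<in> F \<Longrightarrow> bij_betw cl e I"
    and card_I: "card I = r"
    and meet: "e \<in> F \<Longrightarrow> f \<in> F \<Longrightarrow> t \<le> card (e \<inter> f)"
    and no_cover: "T \<subseteq> \<Union>F \<Longrightarrow> card T \<le> r - t \<Longrightarrow> \<exists>f\<in>F. T \<inter> f = {}"
begin

text \<open>Shared vertices are recorded by their classes, so that intersections of different pairs
  of edges become comparable subsets of the one \<open>r\<close>-set \<open>I\<close>.\<close>

definition agree :: "'a set \<Rightarrow> 'a set \<Rightarrow> 'c set" where
  "agree e f = cl ` (e \<inter> f)"

section \<open>Edges as transversals of the classes\<close>

lemma finite_I: "finite I"
  using card_I t_less by (metis card.infinite not_less_zero)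

lemma inj: "e \<in> F \<Longrightarrow> inj_on cl e"
  using bij by (simp add: bij_betw_def)

lemma image_cl: "e \<in> F \<Longrightarrow> cl ` e = I"
  using bij by (simp add: bij_betw_def)

lemma card_edge: "e \<in> F \<Longrightarrow> card e = r"
  using bij card_I bij_betw_same_card by blast

lemma agree_subset: "e \<in> F \<Longrightarrow> agree e f \<subseteq> I"
  using image_cl by (auto simp: agree_def)

lemma card_cl_image: "e \<in> F \<Longrightarrow> A \<subseteq> e \<Longrightarrow> card (cl ` A) = card A"
  by (meson card_image inj inj_on_subset)

lemma card_agree: "e \<in> F \<Longrightarrow> card (agree e f) = card (e \<inter> f)"
  by (simp add: agree_def card_cl_image)

text \<open>In a class where \<open>h\<close> meets both \<open>e\<close> and \<open>f\<close> it
  does so in the same vertex, the only one that it has there.\<close>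

lemma agree_Int: "h \<in> F \<Longrightarrow> agree h e \<inter> agree h f \<subseteq> agree e f"
  using inj[of h] by (auto simp: agree_def inj_on_def)

lemma agree_avoids:
  assumes "e \<in> F" and "A \<subseteq> e" and "A \<inter> h = {}"
  shows "agree h e \<subseteq> I - cl ` A"
  using inj[OF assms(1)] image_cl[OF assms(1)] assms(2,3) by (fastforce simp: agree_def inj_on_def)

lemma card_section:
  assumes "e \<in> F"
  shows "card {v \<in> e. cl v \<in> S} \<le> card (S \<inter> I)"
proof -
  have "cl ` {v \<in> e. cl v \<in> S} \<subseteq> S \<inter> I"
    using image_cl[OF assms] by auto
  then have "card (cl ` {v \<in> e. cl v \<in> S}) \<le> card (S \<inter> I)"
    by (simp add: card_mono finite_I)
  then show ?thesis
    using card_cl_image[OF assms, of "{v \<in> e. cl v \<in> S}"] by auto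
qed

section \<open>Sizes of pairwise intersections\<close>

text \<open>The vertices of \<open>e\<close> and \<open>f\<close> in the classes \<open>S\<close>,
  one per shared class and two per other class, are too few for a cover. An edge \<open>h\<close>
  missing them meets \<open>e\<close> and \<open>f\<close> only outside \<open>S\<close>, at least
  \<open>t\<close> times each, and meets both only in classes of \<open>agree e f\<close>.\<close>

lemma pair_bound:
  assumes e: "e \<in> F" and f: "f \<in> F" and S: "S \<subseteq> I"
    and small: "card (S \<inter> agree e f) + 2 * card (S - agree e f) \<le> r - t"
  shows "2 * t \<le> card (I - S) + card (agree e f - S)"
proof -
  let ?K = "agree e f"
  let ?T1 = "{v \<in> e \<inter> f. cl v \<in> S}"
  let ?T2 = "{v \<in> e. cl v \<in> S - ?K}" and ?T3 = "{v \<in> f. cl v \<in> S - ?K}"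
  have Ke: "cl ` ?T1 \<subseteq> S \<inter> ?K"
    by (auto simp: agree_def)
  have "card ?T1 \<le> card (S \<inter> ?K)"
    using card_mono[OF _ Ke] finite_subset[OF S finite_I] card_cl_image[OF e, of ?T1]
    by (metis (no_types, lifting) Int_iff finite_Int mem_Collect_eq subsetI)
  moreover have "card ?T2 \<le> card (S - ?K)" "card ?T3 \<le> card (S - ?K)"
    using card_section[OF e, of "S - ?K"] card_section[OF f, of "S - ?K"] S
    by (simp_all add: Int_absorb2 Diff_subset subset_trans[OF Diff_subset S])
  moreover have "card (?T1 \<union> ?T2 \<union> ?T3) \<le> card ?T1 + card ?T2 + card ?T3"
    by (meson add_le_mono card_Un_le le_refl order_trans)
  ultimately have "card (?T1 \<union> ?T2 \<union> ?T3) \<le> r - t"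
    using small by linarith
  moreover have "?T1 \<union> ?T2 \<union> ?T3 \<subseteq> \<Union>F"
    using e f by auto
  ultimately obtain h where h: "h \<in> F" and avoid: "(?T1 \<union> ?T2 \<union> ?T3) \<inter> h = {}"
    using no_cover by meson
  have "v \<notin> h" if "v \<in> e" "cl v \<in> S" for v
  proof (cases "cl v \<in> ?K")
    case True
    then have "v \<in> f"
      using inj[OF e] that by (auto simp: agree_def inj_on_def)
    then show ?thesis using avoid that by blast
  qed (use avoid that in blast)
  then have he: "agree h e \<subseteq> I - S"
    using agree_subset[OF h] by (auto simp: agree_def)
  have "v \<notin> h" if "v \<in> f" "cl v \<in> S" for v
  proof (cases "cl v \<in> ?K")
    case True
    then have "v \<in> e"
      using inj[OF f] that by (auto simp: agree_def inj_on_def)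
    then show ?thesis using avoid that by blast
  qed (use avoid that in blast)
  then have hf: "agree h f \<subseteq> I - S"
    using agree_subset[OF h] by (auto simp: agree_def)
  have fin: "finite (agree h e)" "finite (agree h f)"
    using he hf finite_I finite_subset by blast+
  have "2 * t \<le> card (agree h e) + card (agree h f)"
    using meet[OF h e] meet[OF h f] card_agree[OF h] by simp
  also have "\<dots> = card (agree h e \<union> agree h f) + card (agree h e \<inter> agree h f)"
    using card_Un_Int fin by blast
  also have "\<dots> \<le> card (I - S) + card (?K - S)"
  proof (rule add_mono)
    show "card (agree h e \<union> agree h f) \<le> card (I - S)"
      using he hf finite_I by (intro card_mono) auto
    have "finite ?K" using agree_subset[OF e] finite_I finite_subset by blast
    then show "card (agree h e \<inter> agree h f) \<le> card (?K - S)"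
      using agree_Int[OF h] he by (intro card_mono) auto
  qed
  finally show ?thesis .
qed

lemma card_Int_edges:
  assumes e: "e \<in> F" and f: "f \<in> F" and ne: "e \<noteq> f"
  shows "card (e \<inter> f) = t"
proof (rule antisym[OF _ meet[OF e f]], rule ccontr)
  let ?K = "agree e f"
  define k where "k = card ?K"
  assume "\<not> card (e \<inter> f) \<le> t"
  then have kt: "t < k"
    by (simp add: k_def card_agree[OF e])
  have KI: "?K \<subseteq> I" by (rule agree_subset[OF e])
  have finK: "finite ?K" using KI finite_I finite_subset by blast
  have "\<not> e \<subseteq> f"
    using ne card_subset_eq[OF finite_edge[OF f], of e] card_edge[OF e] card_edge[OF f] by auto
  then have "e \<inter> f \<subset> e" by blast
  then have kr: "k < r"
    using psubset_card_mono[OF finite_edge[OF e]] card_edge[OF e] card_agree[OF e]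
    by (simp add: k_def)
  show False
  proof (cases "r - t \<le> k")
    case True
    \<comment> \<open>Each class of \<open>S\<close> costs one vertex. The bound becomes
      \<open>2 * t \<le> t + (k - (r - t))\<close>, against \<open>k < r\<close>.\<close>
    then obtain S where S: "S \<subseteq> ?K" "card S = r - t"
      using obtain_subset_with_card_n[of "r - t" ?K] by (auto simp: k_def)
    have finS: "finite S" using S(1) finK finite_subset by blast
    have "S \<inter> ?K = S" "card (S - ?K) = 0"
      using S(1) by (auto simp: Diff_eq_empty_iff[THEN iffD2])
    then have "2 * t \<le> card (I - S) + card (?K - S)"
      using pair_bound[OF e f subset_trans[OF S(1) KI]] S(2) by simp
    also have "\<dots> = (r - (r - t)) + (k - (r - t))"
      using S KI finS card_I by (simp add: card_Diff_subset k_def)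
    finally show False using kr t_less True by linarith
  next
    case False
    \<comment> \<open>Beyond the \<open>k\<close> shared classes each class costs two vertices.
      Rounding down loses at most one vertex, which \<open>t < k\<close> makes up for:
      \<open>k + x\<close> is at least half of \<open>r\<close>, so fewer than \<open>2 * t\<close>
      classes remain.\<close>
    define x where "x = (r - t - k) div 2"
    have "card (I - ?K) = r - k"
      using KI finK card_I by (simp add: card_Diff_subset k_def)
    moreover have "x \<le> r - k" by (simp add: x_def)
    ultimately obtain X where X: "X \<subseteq> I - ?K" "card X = x"
      using obtain_subset_with_card_n[of x "I - ?K"] by auto
    have finX: "finite X" using X(1) finite_I finite_subset by blast
    have S: "(?K \<union> X) \<inter> ?K = ?K" "(?K \<union> X) - ?K = X" "?K - (?K \<union> X) = {}"
      using X by auto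
    have cS: "card (?K \<union> X) = k + x"
      using X finX finK by (subst card_Un_disjoint) (auto simp: k_def)
    have "2 * t \<le> card (I - (?K \<union> X)) + card (?K - (?K \<union> X))"
      by (rule pair_bound[OF e f])
        (use S X KI False in \<open>auto simp: k_def[symmetric] x_def\<close>)
    also have "\<dots> = r - (k + x)"
      using X KI finX finK card_I cS S by (subst card_Diff_subset) auto
    finally show False using kt r_less False x_def by linarith
  qed
qed

section \<open>Traces of the edges on a fixed edge\<close>

text \<open>An edge \<open>h\<close> missing a part \<open>U\<close> of the kernel has at most
  \<open>t - card U\<close> vertices in the kernel and, as the petals are disjoint, at most
  \<open>r - t\<close> in all petals together. This is too little for sharing \<open>t\<close>
  vertices with each of the three edges.\<close>

lemma no_sunflower:
  assumes e: "e \<in> F" and f: "f \<in> F" and g: "g \<in> F"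
    and P: "e \<inter> f = P" "e \<inter> g = P" "f \<inter> g = P" "card P = t"
  shows False
proof -
  have Pe: "P \<subseteq> e" "P \<subseteq> f" "P \<subseteq> g" using P by auto
  \<comment> \<open>The kernel has \<open>t\<close> vertices and \<open>no_cover\<close> admits
    \<open>r - t\<close>. In the final inequality the first value of the minimum contradicts
    \<open>r < 4 * t\<close>, the second \<open>t < r\<close>.\<close>
  obtain U where U: "U \<subseteq> P" "card U = min t (r - t)"
    using obtain_subset_with_card_n[of "min t (r - t)" P] P(4) by auto
  have "U \<subseteq> \<Union>F" using U Pe e by blast
  then obtain h where h: "h \<in> F" "U \<inter> h = {}"
    using no_cover[of U] U by auto
  let ?S = "cl ` U" and ?A = "cl ` P"
  let ?X = "agree h e" and ?Y = "agree h f" and ?Z = "agree h g"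
  have AI: "?A \<subseteq> I" using image_cl[OF e] Pe by auto
  have SA: "?S \<subseteq> ?A" using U by auto
  have finA: "finite ?A" using AI finite_I finite_subset by blast
  have finS: "finite ?S" using SA finA finite_subset by blast
  have cA: "card ?A = t" using card_cl_image[OF e Pe(1)] P by simp
  have cS: "card ?S = min t (r - t)" using card_cl_image[OF e, of U] U Pe by auto
  have sub: "?X \<subseteq> I - ?S" "?Y \<subseteq> I - ?S" "?Z \<subseteq> I - ?S"
    by (rule agree_avoids; use e f g h(2) U Pe in auto)+
  have pw: "?X \<inter> ?Y \<subseteq> ?A" "?X \<inter> ?Z \<subseteq> ?A" "?Y \<inter> ?Z \<subseteq> ?A"
    using agree_Int[OF h(1)] P by (metis agree_def)+
  have fin: "finite ?X" "finite ?Y" "finite ?Z"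
    by (rule finite_subset[OF _ finite_I], rule agree_subset[OF h(1)])+
  have split: "card B \<le> card (B - ?A) + card (?A - ?S)" if "B \<subseteq> I - ?S" for B
  proof -
    have "finite B" using that finite_I finite_subset by blast
    then have "card B = card (B - ?A) + card (B \<inter> ?A)"
      by (metis Int_commute add.commute card_Int_Diff)
    moreover have "card (B \<inter> ?A) \<le> card (?A - ?S)"
      using that finA by (intro card_mono) auto
    ultimately show ?thesis by simp
  qed
  have "card (?X - ?A) + card (?Y - ?A) + card (?Z - ?A)
      = card ((?X - ?A) \<union> (?Y - ?A) \<union> (?Z - ?A))"
  proof -
    have "(?X - ?A) \<inter> (?Y - ?A) = {}" "((?X - ?A) \<union> (?Y - ?A)) \<inter> (?Z - ?A) = {}"
      using pw by blast+
    then show ?thesis using fin by (simp add: card_Un_disjoint)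
  qed
  also have "\<dots> \<le> card (I - ?A)"
    using sub finite_I by (intro card_mono) auto
  also have "\<dots> = r - t"
    using card_Diff_subset[OF finA AI] card_I cA by simp
  finally have 1: "card (?X - ?A) + card (?Y - ?A) + card (?Z - ?A) \<le> r - t" .
  have 2: "card (?A - ?S) = t - min t (r - t)"
    using card_Diff_subset[OF finS SA] cA cS by simp
  have "t \<le> card ?X" "t \<le> card ?Y" "t \<le> card ?Z"
    using meet[OF h(1)] e f g card_agree[OF h(1)] by simp_all
  then have "3 * t \<le> (r - t) + 3 * (t - min t (r - t))"
    using 1 2 split[OF sub(1)] split[OF sub(2)] split[OF sub(3)] by linarith
  then show False using t_less r_less by linarith
qed

text \<open>If \<open>e\<close> meets \<open>f\<close> and \<open>g\<close> in the same
  \<open>t\<close>-set, this set fills \<open>f \<inter> g\<close>, which also has \<open>t\<close>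
  elements; this is a sunflower.\<close>

lemma inj_on_Int:
  assumes e: "e \<in> F"
  shows "inj_on ((\<inter>) e) (F - {e})"
proof (rule inj_onI, rule ccontr)
  fix f g assume f: "f \<in> F - {e}" and g: "g \<in> F - {e}" and eq: "e \<inter> f = e \<inter> g" and ne: "f \<noteq> g"
  have c: "card (e \<inter> f) = t" "card (f \<inter> g) = t"
    using card_Int_edges e f g ne by auto
  have "e \<inter> f \<subseteq> f \<inter> g" using eq by blast
  moreover have "finite (f \<inter> g)" using f finite_edge by blast
  ultimately have "f \<inter> g = e \<inter> f"
    using c card_subset_eq by metis
  then show False
    using no_sunflower[OF e _ _ refl eq[symmetric] _ c(1)] f g by auto
qed

text \<open>Some edge misses \<open>e - P\<close>; its intersection with \<open>e\<close> lies in
  \<open>P\<close> and has at least \<open>t\<close> elements.\<close>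

lemma ex_Int:
  assumes e: "e \<in> F" and P: "P \<subseteq> e" "card P = t"
  shows "\<exists>f\<in>F - {e}. e \<inter> f = P"
proof -
  have "card (e - P) = r - t"
    using P card_edge[OF e] finite_edge[OF e] by (simp add: card_Diff_subset finite_subset)
  then obtain f where f: "f \<in> F" "(e - P) \<inter> f = {}"
    using no_cover[of "e - P"] e by auto
  have sub: "e \<inter> f \<subseteq> P" using f by auto
  moreover have "finite P" using P finite_edge[OF e] finite_subset by blast
  ultimately have "e \<inter> f = P"
    using meet[OF e f(1)] P by (metis card_mono card_subset_eq le_antisym)
  moreover have "e \<noteq> f"
    using calculation P card_edge[OF e] t_less by auto
  ultimately show ?thesis using f by auto
qed

section \<open>Counting edges and degrees\<close>

text \<open>Intersecting with \<open>e\<close> matches the other edges with the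
  \<open>t\<close>-subsets of \<open>e\<close>.\<close>

lemma card_F:
  assumes e: "e \<in> F"
  shows "card F = 1 + (r choose t)"
proof -
  have "(\<inter>) e ` (F - {e}) = {P. P \<subseteq> e \<and> card P = t}"
  proof (intro equalityI subsetI)
    fix P assume "P \<in> {P. P \<subseteq> e \<and> card P = t}"
    then show "P \<in> (\<inter>) e ` (F - {e})" using ex_Int[OF e, of P] by blast
  qed (use card_Int_edges[OF e] in auto)
  then have "card (F - {e}) = r choose t"
    using n_subsets[OF finite_edge[OF e], of t] card_image[OF inj_on_Int[OF e]] card_edge[OF e]
    by simp
  then show ?thesis
    using e finite_F card_Suc_Diff1 by fastforce
qed

text \<open>The edges missing \<open>v\<close> correspond to the \<open>t\<close>-subsets of
  \<open>e - {v}\<close>; Pascal's rule gives the rest.\<close>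

lemma degree:
  assumes e: "e \<in> F" and v: "v \<in> e"
  shows "card {f \<in> F. v \<in> f} = 1 + ((r - 1) choose (t - 1))"
proof -
  let ?N = "{f \<in> F. v \<notin> f}"
  have "(\<inter>) e ` ?N = {P. P \<subseteq> e - {v} \<and> card P = t}"
  proof (intro equalityI subsetI)
    fix P assume "P \<in> {P. P \<subseteq> e - {v} \<and> card P = t}"
    then have P: "P \<subseteq> e" "card P = t" "v \<notin> P" by auto
    obtain f where "f \<in> F" "e \<inter> f = P" using ex_Int[OF e P(1,2)] by auto
    then show "P \<in> (\<inter>) e ` ?N" using P v by blast
  qed (use card_Int_edges[OF e] v in auto)
  moreover have "inj_on ((\<inter>) e) ?N"
    by (rule inj_on_subset[OF inj_on_Int[OF e]]) (use v in auto)
  ultimately have N: "card ?N = (r - 1) choose t"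
    using n_subsets[of "e - {v}" t] finite_edge[OF e] card_edge[OF e] v
    by (metis (no_types, lifting) card_Diff_singleton card_image finite_Diff)
  have "card F = card {f \<in> F. v \<in> f} + card ?N"
    using finite_F by (subst card_Un_disjoint[symmetric]) (auto intro: arg_cong[where f = card])
  moreover have "r choose t = ((r - 1) choose (t - 1)) + ((r - 1) choose t)"
    using choose_reduce_nat[of r t] t_pos t_less by simp
  ultimately show ?thesis using card_F[OF e] N by simp
qed

text \<open>Each edge has exactly one vertex in the class \<open>i\<close>, so the vertices of
  \<open>Q\<close> split the edges into stars of equal size. As \<open>Q\<close> is a cover, it is
  too large for this.\<close>

lemma contradiction: False
proof -
  obtain e where e: "e \<in> F"
    using no_cover[of "{}"] by auto
  obtain i where i: "i \<in> I"
    using card_I t_less by fastforce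
  define Q where "Q = {v \<in> \<Union>F. cl v = i}"
  define c where "c = (r - 1) choose (t - 1)"
  have finQ: "finite Q" using finite_F finite_edge by (auto simp: Q_def)
  have hit: "Q \<inter> f \<noteq> {}" if "f \<in> F" for f
    using that i image_cl[OF that] by (auto simp: Q_def)
  have "\<not> card Q \<le> r - t"
    using no_cover[of Q] hit by (auto simp: Q_def)
  then have Q: "r - t + 1 \<le> card Q" by simp
  have "F = (\<Union>v\<in>Q. {f \<in> F. v \<in> f})"
    using hit by blast
  moreover have "card (\<Union>v\<in>Q. {f \<in> F. v \<in> f}) = (\<Sum>v\<in>Q. card {f \<in> F. v \<in> f})"
    using finQ finite_F inj by (intro card_UN_disjoint) (auto simp: Q_def inj_on_def)
  moreover have "\<dots> = (\<Sum>v\<in>Q. 1 + c)"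
    using degree by (intro sum.cong) (auto simp: Q_def c_def)
  ultimately have "1 + (r choose t) = card Q * (1 + c)"
    using card_F[OF e] by simp
  \<comment> \<open>The factor \<open>t\<close> lets the absorption identity express
    \<open>r choose t\<close> through \<open>c\<close>.\<close>
  then have "t + t * (r choose t) = card Q * t * (1 + c)"
    by (metis (no_types, opaque_lifting) add_mult_distrib2 mult.assoc mult.commute mult_1_right)
  moreover have "t * (r choose t) = r * c"
    using times_binomial_minus1_eq[OF t_pos, of r] by (simp add: c_def)
  ultimately have eq: "t + r * c = card Q * t * (1 + c)" by simp
  \<comment> \<open>With \<open>t = a + 1\<close> and \<open>r = t + b\<close> the two sides differ
    by \<open>a * b\<close>. Hence the right side of \<open>eq\<close> is at least
    \<open>r + r * c\<close>, more than \<open>t + r * c\<close>.\<close>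
  have "r \<le> (r - t + 1) * t"
  proof -
    obtain a b where "t = Suc a" "r = t + b"
      using t_pos t_less by (metis gr0_implies_Suc less_imp_add_positive)
    then show ?thesis by simp
  qed
  also have "\<dots> \<le> card Q * t" using Q mult_le_mono1 by blast
  finally have "r * (1 + c) \<le> card Q * t * (1 + c)" using mult_le_mono1 by blast
  then show False using eq t_less by (simp add: algebra_simps)
qed

end

section \<open>Passage to hypergraphs with repeated edges\<close>

lemma ex_small_cover:
  fixes r t :: nat
  assumes t: "t < r" "r < 4 * t"
    and H: "hypergraph V E" and u: "uniform r E" and p: "partite r V E" and int: "intersecting t E"
  shows "\<exists>T. vertex_cover V E T \<and> card T \<le> r - t"
proof (rule ccontr)
  assume none: "\<not> ?thesis"
  obtain I where I: "partition_on V I" "card I = r"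
    and one: "\<And>e C x y. e \<in># E \<Longrightarrow> C \<in> I \<Longrightarrow> x \<in> e \<Longrightarrow> y \<in> e \<Longrightarrow> x \<in> C \<Longrightarrow> y \<in> C \<Longrightarrow> x = y"
    using p unfolding partite_def by (metis empty_subsetI insert_subset)
  define cl where "cl v = (SOME C. C \<in> I \<and> v \<in> C)" for v
  have cl: "cl v \<in> I \<and> v \<in> cl v" if "v \<in> V" for v
    unfolding cl_def
    using that partition_onD1[OF I(1)] someI_ex[of "\<lambda>C. C \<in> I \<and> v \<in> C"] by blast
  have sub: "e \<subseteq> V" "finite e" if "e \<in># E" for e
    using H that finite_subset by (auto simp: hypergraph_def)
  have card: "card e = r" if "e \<in># E" for e
    using u that by (simp add: uniform_def)
  have "uncoverable r t (set_mset E) cl I"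
  proof
    show "0 < t" "t < r" "r < 4 * t" "finite (set_mset E)" "card I = r"
      using t I by auto
    show "finite e" if "e \<in># E" for e using sub that by blast
    show "bij_betw cl e I" if e: "e \<in># E" for e
    proof -
      have inj: "inj_on cl e"
        by (rule inj_onI) (metis cl e one sub(1) subsetD)
      have "cl ` e \<subseteq> I" using cl sub(1)[OF e] by auto
      moreover have "finite I" using I(2) t(1) by (metis card.infinite not_less_zero)
      ultimately have "cl ` e = I"
        using card_image[OF inj] card[OF e] I(2) card_subset_eq by metis
      then show ?thesis using inj by (simp add: bij_betw_def)
    qed
    show "t \<le> card (e \<inter> f)" if e: "e \<in># E" and f: "f \<in># E" for e f
    \<comment> \<open>\<open>intersecting\<close> pairs an edge with itself only if it is repeated,
      so the case \<open>e = f\<close> rests on uniformity and \<open>t < r\<close>.\<close>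
    proof (cases "e = f")
      case True
      then show ?thesis using card[OF e] t by simp
    next
      case False
      then have "{#e, f#} \<subseteq># E"
        using e f by (simp add: insert_subset_eq_iff in_diff_count)
      then show ?thesis using int by (simp add: intersecting_def)
    qed
    show "\<exists>f\<in>#E. T \<inter> f = {}" if T: "T \<subseteq> \<Union>(set_mset E)" "card T \<le> r - t" for T
    proof -
      have "T \<subseteq> V" using T(1) sub(1) by (meson Union_least subset_trans)
      then show ?thesis using none T(2) by (auto simp: vertex_cover_def)
    qed
  qed
  then show False by (rule uncoverable.contradiction)
qed

theorem theorem2:
  fixes r t :: nat and V :: "'a set" and E :: "'a set multiset"
  assumes "real r / 4 < real t" and "int t \<le> int r - 1"
    and "hypergraph V E"
    and "uniform r E"
    and "partite r V E"
    and "intersecting t E"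
  shows "int (covering_number V E) \<le> int r - int t"
proof -
  have t: "t < r" "r < 4 * t" using assms(1,2) by linarith+
  obtain T where T: "vertex_cover V E T" "card T \<le> r - t"
    using ex_small_cover[OF t assms(3-6)] by blast
  have "finite {T. vertex_cover V E T}"
    by (rule finite_subset[of _ "Pow V"])
      (use assms(3) in \<open>auto simp: vertex_cover_def hypergraph_def\<close>)
  then have "finite {card T | T. vertex_cover V E T}"
    by simp
  then have "covering_number V E \<le> card T"
    unfolding covering_number_def using T by (intro Min_le) auto
  then show ?thesis using T t by linarith
qed

end
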